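(* Let $P$ (real) and $\widehat P$ (surrogate) be two environments, and let $\Pi_L$ and $\Pi_F$ be nonempty restricted classes of leader and follower policies, such that for each $M\in\{P,\widehat P\}$ the maxima defining the follower best responses, the optimistic selector, and the optimal reduced leader value are attained. Let $J_F^M$ be the follower value, $V_L^M$ the reduced leader Stackelberg value, and $\mathcal{R}_L^M$, $\mathcal{R}_F^M$ the restricted leader and follower regrets in environment $M$ (defined in the context). Suppose that $$\sup_{\pi_L\in\Pi_L,\;\pi_F\in\Pi_F}\bigl|J_F^P(\pi_L,\pi_F)-J_F^{\widehat P}(\pi_L,\pi_F)\bigr|\le\delta_F,\qquad \sup_{\pi_L\in\Pi_L}\bigl|V_L^P(\pi_L)-V_L^{\widehat P}(\pi_L)\bigr|\le\delta_L .$$ If $(\widehat\pi_L,\widehat\pi_F)\in\Pi_L\times\Pi_F$ is an $(\epsilon_L,\epsilon_F)$ restricted approximate Stackelberg operating point under $\widehat P$, that is, $$\mathcal{R}_L^{\widehat P}(\widehat\pi_L)\le\epsilon_L\quad\text{and}\quad \mathcal{R}_F^{\widehat P}(\widehat\pi_L,\widehat\pi_F)\le\epsilon_F,$$ then under $P$, $$\mathcal{R}_L^P(\widehat\pi_L)\le\epsilon_L+2\delta_L\qquad\text{and}\qquad \mathcal{R}_F^P(\widehat\pi_L,\widehat\pi_F)\le\epsilon_F+2\delta_F .$$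
   Context: Setting. $\mathcal{X}$ is a state space, $\mathcal{L}=[q_{\min},q_{\max}]\times[0,1]$ the set of feasible leader signals, $\mathcal{A}=[0,1]^3$ the set of follower actions, and $U_L,U_F:\mathcal{X}\times\mathcal{L}\times\mathcal{A}\to\mathbb{R}$ the stage utilities of leader and follower. $H\in\mathbb{N}$ is a finite horizon and $\gamma\in[0,1]$ a discount factor. An environment $M$ is a transition law which, given $(x_t,\ell_t,a_t)$, generates the next state $x_{t+1}$ (together with a cost and a quality signal); the initial state distribution is fixed. A leader policy $\pi_L$ draws a raw signal $\tilde\ell_t\sim\pi_L(\cdot\mid x_t)$, which is projected onto $\mathcal{L}$ to give $\ell_t$; a follower policy $\pi_F$ draws $a_t\sim\pi_F(\cdot\mid x_t,\ell_t)$. Write $\tau\sim(\pi_L,\pi_F,M)$ for the resulting random trajectory. For $i\in\{L,F\}$ the policy value (assumed to be a well-defined real number) is $$J_i^M(\pi_L,\pi_F):=\mathbb{E}_{\tau\sim(\pi_L,\pi_F,M)}\Bigl[\sum_{t=0}^{H-1}\gamma^t\,U_i(x_t,\ell_t,a_t)\Bigr].$$ Restricted follower best responses to $\pi_L\in\Pi_L$: $$\mathfrak{BR}_F^M(\pi_L):=\arg\max_{\pi_F\in\Pi_F}J_F^M(\pi_L,\pi_F).$$ Optimistic selector: $b_M(\pi_L)\in\mathfrak{BR}_F^M(\pi_L)$ is chosen to maximize $J_L^M(\pi_L,\cdot)$ over $\mathfrak{BR}_F^M(\pi_L)$. Reduced leader Stackelberg value: $$V_L^M(\pi_L):=J_L^M\bigl(\pi_L,b_M(\pi_L)\bigr).$$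 Restricted regrets: $$\mathcal{R}_F^M(\pi_L,\pi_F):=\sup_{\pi_F'\in\Pi_F}J_F^M(\pi_L,\pi_F')-J_F^M(\pi_L,\pi_F),\qquad \mathcal{R}_L^M(\pi_L):=\sup_{\pi_L'\in\Pi_L}V_L^M(\pi_L')-V_L^M(\pi_L).$$ Standing assumption: the classes $\Pi_L,\Pi_F$ are such that all these maxima are attained (finite classes suffice), for both $M=P$ and $M=\widehat P$. Here $\epsilon_L,\epsilon_F,\delta_L,\delta_F$ are nonnegative real numbers. *)

theory Defs
  imports "HOL-Probability.Probability"
begin

type_synonym signal = "real \<times> real"
type_synonym action = "real ^ 3"

datatype player = Leader | Follower

text \<open>
  The data shared by the real and the surrogate environment.  The quality signal emitted along with
  the next state lives in an arbitrary measurable space.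
\<close>

record ('x, 'y) game =
  states :: "'x measure"
  qualities :: "'y measure"
  init :: "'x measure"
  q_min :: real
  q_max :: real
  stage_utility :: "player \<Rightarrow> 'x \<times> signal \<times> action \<Rightarrow> real"
  horizon :: nat
  discount :: real

definition signals :: "('x, 'y) game \<Rightarrow> signal set" where
  "signals G = {q_min G..q_max G} \<times> {0..1}"

definition actions :: "action set" where
  "actions = {a. \<forall>i. a $ i \<in> {0..1}}"

definition signal_space :: "('x, 'y) game \<Rightarrow> signal measure" where
  "signal_space G = restrict_space borel (signals G)"

definition action_space :: "action measure" where
  "action_space = restrict_space borel actions"

definition game :: "('x, 'y) game \<Rightarrow> bool" where
  "game G \<longleftrightarrow> init G \<in> space (prob_algebra (states G)) \<and> q_min G \<le> q_max G \<and>
     0 \<le> discount G \<and> discount G \<le> 1"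

text \<open>
  An environment is a Markov kernel from (state, signal, action) to (next state, cost, quality).
  Leader policies emit raw signals in the plane; projection happens in the dynamics.
\<close>

type_synonym ('x, 'y) environment = "'x \<times> signal \<times> action \<Rightarrow> ('x \<times> real \<times> 'y) measure"
type_synonym 'x leader_policy = "'x \<Rightarrow> signal measure"
type_synonym 'x follower_policy = "'x \<times> signal \<Rightarrow> action measure"

definition environments :: "('x, 'y) game \<Rightarrow> ('x, 'y) environment set" where
  "environments G =
     (states G \<Otimes>\<^sub>M signal_space G \<Otimes>\<^sub>M action_space) \<rightarrow>\<^sub>M
       prob_algebra (states G \<Otimes>\<^sub>M borel \<Otimes>\<^sub>M qualities G)"

definition leader_policies :: "('x, 'y) game \<Rightarrow> 'x leader_policy set" where
  "leader_policies G = states G \<rightarrow>\<^sub>M prob_algebra borel"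

definition follower_policies :: "('x, 'y) game \<Rightarrow> 'x follower_policy set" where
  "follower_policies G = (states G \<Otimes>\<^sub>M signal_space G) \<rightarrow>\<^sub>M prob_algebra action_space"

text \<open>
  A trajectory is a map sending each period \<open>t\<close> below the horizon to the tuple
  (state, projected signal, action, cost, quality), paired with the state reached after the last
  period.
\<close>

type_synonym ('x, 'y) stage = "'x \<times> signal \<times> action \<times> real \<times> 'y"

definition stage_space :: "('x, 'y) game \<Rightarrow> ('x, 'y) stage measure" where
  "stage_space G = states G \<Otimes>\<^sub>M signal_space G \<Otimes>\<^sub>M action_space \<Otimes>\<^sub>M borel \<Otimes>\<^sub>M qualities G"

definition trajectory_space :: "('x, 'y) game \<Rightarrow> nat \<Rightarrow> ((nat \<Rightarrow> ('x, 'y) stage) \<times> 'x) measure" where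
  "trajectory_space G n = (\<Pi>\<^sub>M t\<in>{..<n}. stage_space G) \<Otimes>\<^sub>M states G"

definition stage_kernel ::
    "('x, 'y) game \<Rightarrow> ('x, 'y) environment \<Rightarrow> 'x leader_policy \<Rightarrow> 'x follower_policy \<Rightarrow>
     'x \<Rightarrow> (('x, 'y) stage \<times> 'x) measure" where
  "stage_kernel G M \<pi>L \<pi>F x =
     do {
       l \<leftarrow> distr (\<pi>L x) (signal_space G) (closest_point (signals G));
       a \<leftarrow> \<pi>F (x, l);
       (x', c, y) \<leftarrow> M (x, l, a);
       return (stage_space G \<Otimes>\<^sub>M states G) ((x, l, a, c, y), x')
     }"

primrec trajectory_law ::
    "('x, 'y) game \<Rightarrow> ('x, 'y) environment \<Rightarrow> 'x leader_policy \<Rightarrow> 'x follower_policy \<Rightarrow>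
     nat \<Rightarrow> ((nat \<Rightarrow> ('x, 'y) stage) \<times> 'x) measure" where
  "trajectory_law G M \<pi>L \<pi>F 0 =
     distr (init G) (trajectory_space G 0) (\<lambda>x. (\<lambda>_. undefined, x))"
| "trajectory_law G M \<pi>L \<pi>F (Suc n) =
     do {
       (h, x) \<leftarrow> trajectory_law G M \<pi>L \<pi>F n;
       (s, x') \<leftarrow> stage_kernel G M \<pi>L \<pi>F x;
       return (trajectory_space G (Suc n)) (h(n := s), x')
     }"

text \<open>
  Outside its measurability side conditions the monadic bind is junk; these facts rule that out.
\<close>

lemma measurable_projection: assumes "game G" shows "closest_point (signals G) \<in> borel \<rightarrow>\<^sub>M signal_space G"
proof -
  have s: "signals G = cbox (q_min G,0) (q_max G,1)" unfolding signals_def by (simp add: cbox_Pair_eq)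
  have ne: "signals G \<noteq> {}" using assms by (auto simp: signals_def game_def)
  have "closest_point (signals G) \<in> borel_measurable borel"
    by (intro borel_measurable_continuous_onI continuous_on_closest_point ne) (auto simp: s)
  then show ?thesis unfolding signal_space_def
    by (intro measurable_restrict_space2) (use closest_point_in_set[OF _ ne] in \<open>auto simp: s\<close>)
qed

lemma measurable_stage_kernel: assumes "game G" and "M \<in> environments G" "\<pi>L \<in> leader_policies G" "\<pi>F \<in> follower_policies G"
  shows "stage_kernel G M \<pi>L \<pi>F \<in> states G \<rightarrow>\<^sub>M prob_algebra (stage_space G \<Otimes>\<^sub>M states G)"
proof -
  note [measurable] = measurable_projection[OF assms(1)] assms(2-4)[unfolded environments_def leader_policies_def follower_policies_def]
  show ?thesis unfolding stage_kernel_def[abs_def] stage_space_def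
    by measurable
qed

lemma trajectory_law_in_prob_algebra: assumes "game G" and  "M \<in> environments G" "\<pi>L \<in> leader_policies G" "\<pi>F \<in> follower_policies G"
  shows "trajectory_law G M \<pi>L \<pi>F n \<in> space (prob_algebra (trajectory_space G n))"
proof (induction n)
  case 0
  have i: "init G \<in> space (prob_algebra (states G))" using assms(1) by (simp add: game_def)
  have [measurable]: "(\<lambda>x. (\<lambda>_. undefined, x)) \<in> states G \<rightarrow>\<^sub>M trajectory_space G 0"
    unfolding trajectory_space_def by (intro measurable_Pair) (auto intro!: measurable_const simp: space_PiM)
  show ?case using i by (auto simp: space_prob_algebra intro!: prob_space.prob_space_distr)
next
  case (Suc n)
  note [measurable] = measurable_stage_kernel[OF assms]
  have [measurable]: "(\<lambda>(h,s). h(n:=s)) \<in> (\<Pi>\<^sub>M t\<in>{..<n}. stage_space G) \<Otimes>\<^sub>M stage_space G \<rightarrow>\<^sub>M (\<Pi>\<^sub>M t\<in>{..<Suc n}. stage_space G)"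
    unfolding lessThan_Suc by (rule measurable_add_dim)
  have u[measurable]: "(\<lambda>w. (fst (fst w))(n := fst (snd w))) \<in> trajectory_space G n \<Otimes>\<^sub>M (stage_space G \<Otimes>\<^sub>M states G) \<rightarrow>\<^sub>M (\<Pi>\<^sub>M t\<in>{..<Suc n}. stage_space G)"
    unfolding trajectory_space_def
    by (rule measurable_compose[where f="\<lambda>w. (fst (fst w), fst (snd w))" and g="\<lambda>(h,s). h(n:=s)", simplified]) measurable
  have k: "(\<lambda>w. return (trajectory_space G (Suc n)) ((fst (fst w))(n := fst (snd w)), snd (snd w))) \<in> trajectory_space G n \<Otimes>\<^sub>M (stage_space G \<Otimes>\<^sub>M states G) \<rightarrow>\<^sub>M prob_algebra (trajectory_space G (Suc n))"
    apply (rule measurable_compose[OF _ measurable_return_prob_space])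
    unfolding trajectory_space_def[of G "Suc n"] by measurable
  have "(\<lambda>z. stage_kernel G M \<pi>L \<pi>F (snd z) \<bind> (\<lambda>s. return (trajectory_space G (Suc n)) ((fst z)(n := fst s), snd s)))
     \<in> trajectory_space G n \<rightarrow>\<^sub>M prob_algebra (trajectory_space G (Suc n))"
    apply (rule measurable_bind_prob_space2[where N="stage_space G \<Otimes>\<^sub>M states G"])
    subgoal unfolding trajectory_space_def by measurable
    subgoal using k by (simp add: split_beta')
    done
  with Suc show ?case
    by (auto simp: split_beta' dest: measurable_bind_prob_space
       intro!: prob_space_bind' sets_bind' simp: space_prob_algebra)
qed

definition discounted_return ::
    "player \<Rightarrow> ('x, 'y) game \<Rightarrow> (nat \<Rightarrow> ('x, 'y) stage) \<times> 'x \<Rightarrow> real" where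
  "discounted_return i G \<tau> =
     (\<Sum>t<horizon G. discount G ^ t *
        (case fst \<tau> t of (x, l, a, c, y) \<Rightarrow> stage_utility G i (x, l, a)))"

text \<open>
  Bochner integrals default to 0, so the policy value is meaningful only where the following
  predicate holds.
\<close>

definition value_defined ::
    "player \<Rightarrow> ('x, 'y) game \<Rightarrow> ('x, 'y) environment \<Rightarrow> 'x leader_policy \<Rightarrow> 'x follower_policy \<Rightarrow> bool" where
  "value_defined i G M \<pi>L \<pi>F \<longleftrightarrow>
     integrable (trajectory_law G M \<pi>L \<pi>F (horizon G)) (discounted_return i G)"

definition policy_value ::
    "player \<Rightarrow> ('x, 'y) game \<Rightarrow> ('x, 'y) environment \<Rightarrow> 'x leader_policy \<Rightarrow> 'x follower_policy \<Rightarrow> real" where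
  "policy_value i G M \<pi>L \<pi>F =
     (\<integral>\<tau>. discounted_return i G \<tau> \<partial>trajectory_law G M \<pi>L \<pi>F (horizon G))"

definition best_responses ::
    "('x, 'y) game \<Rightarrow> ('x, 'y) environment \<Rightarrow> 'x follower_policy set \<Rightarrow> 'x leader_policy \<Rightarrow>
     'x follower_policy set" where
  "best_responses G M \<Pi>F \<pi>L =
     {\<pi>F. is_arg_max (policy_value Follower G M \<pi>L) (\<lambda>\<pi>. \<pi> \<in> \<Pi>F) \<pi>F}"

definition optimistic_selector ::
    "('x, 'y) game \<Rightarrow> ('x, 'y) environment \<Rightarrow> 'x follower_policy set \<Rightarrow> 'x leader_policy \<Rightarrow>
     'x follower_policy" where
  "optimistic_selector G M \<Pi>F \<pi>L =
     arg_max_on (policy_value Leader G M \<pi>L) (best_responses G M \<Pi>F \<pi>L)"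

definition leader_value ::
    "('x, 'y) game \<Rightarrow> ('x, 'y) environment \<Rightarrow> 'x follower_policy set \<Rightarrow> 'x leader_policy \<Rightarrow> real" where
  "leader_value G M \<Pi>F \<pi>L = policy_value Leader G M \<pi>L (optimistic_selector G M \<Pi>F \<pi>L)"

definition maxima_attained ::
    "('x, 'y) game \<Rightarrow> ('x, 'y) environment \<Rightarrow> 'x leader_policy set \<Rightarrow> 'x follower_policy set \<Rightarrow> bool" where
  "maxima_attained G M \<Pi>L \<Pi>F \<longleftrightarrow>
     (\<forall>\<pi>L\<in>\<Pi>L. best_responses G M \<Pi>F \<pi>L \<noteq> {} \<and>
        (\<exists>\<pi>F. is_arg_max (policy_value Leader G M \<pi>L) (\<lambda>\<pi>. \<pi> \<in> best_responses G M \<Pi>F \<pi>L) \<pi>F)) \<and>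
     (\<exists>\<pi>L. is_arg_max (leader_value G M \<Pi>F) (\<lambda>\<pi>. \<pi> \<in> \<Pi>L) \<pi>L)"

text \<open>
  The real-valued suprema below are the intended ones whenever \<^const>\<open>maxima_attained\<close> holds, since
  the sets are then nonempty and bounded above.
\<close>

definition follower_regret ::
    "('x, 'y) game \<Rightarrow> ('x, 'y) environment \<Rightarrow> 'x follower_policy set \<Rightarrow> 'x leader_policy \<Rightarrow>
     'x follower_policy \<Rightarrow> real" where
  "follower_regret G M \<Pi>F \<pi>L \<pi>F =
     (SUP \<pi>F'\<in>\<Pi>F. policy_value Follower G M \<pi>L \<pi>F') - policy_value Follower G M \<pi>L \<pi>F"

definition leader_regret ::
    "('x, 'y) game \<Rightarrow> ('x, 'y) environment \<Rightarrow> 'x leader_policy set \<Rightarrow> 'x follower_policy set \<Rightarrow>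
     'x leader_policy \<Rightarrow> real" where
  "leader_regret G M \<Pi>L \<Pi>F \<pi>L =
     (SUP \<pi>L'\<in>\<Pi>L. leader_value G M \<Pi>F \<pi>L') - leader_value G M \<Pi>F \<pi>L"

definition approx_stackelberg_point ::
    "('x, 'y) game \<Rightarrow> ('x, 'y) environment \<Rightarrow> 'x leader_policy set \<Rightarrow> 'x follower_policy set \<Rightarrow>
     real \<Rightarrow> real \<Rightarrow> 'x leader_policy \<Rightarrow> 'x follower_policy \<Rightarrow> bool" where
  "approx_stackelberg_point G M \<Pi>L \<Pi>F \<epsilon>L \<epsilon>F \<pi>L \<pi>F \<longleftrightarrow>
     \<pi>L \<in> \<Pi>L \<and> \<pi>F \<in> \<Pi>F \<and>
     leader_regret G M \<Pi>L \<Pi>F \<pi>L \<le> \<epsilon>L \<and> follower_regret G M \<Pi>F \<pi>L \<pi>F \<le> \<epsilon>F"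

end

theory Submission
  imports Defs
begin

text \<open>Both regrets have the form sup f - f(a). If f and g differ by at most \<delta> at every
  point of the class, passing from g to f raises the supremum by at most \<delta> and lowers the
  value at a by at most \<delta>, so the regret grows by at most 2\<delta>. This is
  \<open>regret_transfer\<close>, used twice: with the reduced leader value on \<Pi>L, and with the
  follower value on \<Pi>F while the leader stays at \<open>\<pi>L_hat\<close>. Closeness is assumed
  for the reduced values themselves, so the two environments' optimistic selectors never have to be
  compared.\<close>

text \<open>Turns attainment of a maximum into the boundedness that makes a real-valued
  \<open>SUP\<close> a genuine upper bound.\<close>

lemma is_arg_max_bdd_above:
  fixes f :: "'a \<Rightarrow> 'b::linorder"
  assumes "is_arg_max f (\<lambda>x. x \<in> A) x"
  shows "bdd_above (f ` A)"
  using assms by (intro bdd_aboveI2[of A f "f x"]) (auto simp: is_arg_max_linorder)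

lemma regret_transfer:
  fixes f g :: "'a \<Rightarrow> real"
  assumes bdd: "bdd_above (g ` A)"
    and close: "\<And>x. x \<in> A \<Longrightarrow> \<bar>f x - g x\<bar> \<le> \<delta>"
    and a: "a \<in> A"
    and regret: "(SUP x\<in>A. g x) - g a \<le> \<epsilon>"
  shows "(SUP x\<in>A. f x) - f a \<le> \<epsilon> + 2 * \<delta>"
proof -
  \<comment> \<open>The first \<delta>: f is at most g + \<delta> pointwise, and g is at most its
    supremum because it is bounded above. The point \<open>a\<close> witnesses that the class is
    nonempty.\<close>
  have "(SUP x\<in>A. f x) \<le> (SUP x\<in>A. g x) + \<delta>"
  proof (rule cSUP_least)
    fix x assume x: "x \<in> A"
    have "g x \<le> (SUP x\<in>A. g x)"
      using x bdd by (rule cSUP_upper)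
    then show "f x \<le> (SUP x\<in>A. g x) + \<delta>"
      using close[OF x] by linarith
  qed (use a in auto)
  \<comment> \<open>The second \<delta> is the gap between f and g at \<open>a\<close>
    itself.\<close>
  then show ?thesis
    using close[OF a] regret by linarith
qed

theorem theorem5p4:
  fixes G :: "('x, 'y) game"
    and P P_hat :: "('x, 'y) environment"
    and \<Pi>L :: "'x leader_policy set" and \<Pi>F :: "'x follower_policy set"
    and \<pi>L_hat :: "'x leader_policy" and \<pi>F_hat :: "'x follower_policy"
    and \<epsilon>L \<epsilon>F \<delta>L \<delta>F :: real
  assumes "game G"
    and "P \<in> environments G" and "P_hat \<in> environments G"
    and "\<Pi>L \<subseteq> leader_policies G" and "\<Pi>L \<noteq> {}"
    and "\<Pi>F \<subseteq> follower_policies G" and "\<Pi>F \<noteq> {}"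
    and "\<And>i M \<pi>L \<pi>F. M \<in> {P, P_hat} \<Longrightarrow> \<pi>L \<in> \<Pi>L \<Longrightarrow> \<pi>F \<in> \<Pi>F \<Longrightarrow> value_defined i G M \<pi>L \<pi>F"
    and "\<And>M. M \<in> {P, P_hat} \<Longrightarrow> maxima_attained G M \<Pi>L \<Pi>F"
    and "\<epsilon>L \<ge> 0" and "\<epsilon>F \<ge> 0" and "\<delta>L \<ge> 0" and "\<delta>F \<ge> 0"
    and "(SUP (\<pi>L, \<pi>F) \<in> \<Pi>L \<times> \<Pi>F.
            ereal \<bar>policy_value Follower G P \<pi>L \<pi>F - policy_value Follower G P_hat \<pi>L \<pi>F\<bar>) \<le> ereal \<delta>F"
    and "(SUP \<pi>L \<in> \<Pi>L. ereal \<bar>leader_value G P \<Pi>F \<pi>L - leader_value G P_hat \<Pi>F \<pi>L\<bar>) \<le> ereal \<delta>L"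
    and "approx_stackelberg_point G P_hat \<Pi>L \<Pi>F \<epsilon>L \<epsilon>F \<pi>L_hat \<pi>F_hat"
  shows "leader_regret G P \<Pi>L \<Pi>F \<pi>L_hat \<le> \<epsilon>L + 2 * \<delta>L \<and>
         follower_regret G P \<Pi>F \<pi>L_hat \<pi>F_hat \<le> \<epsilon>F + 2 * \<delta>F"
proof
  have hat: "\<pi>L_hat \<in> \<Pi>L" "\<pi>F_hat \<in> \<Pi>F"
    and regret_L: "leader_regret G P_hat \<Pi>L \<Pi>F \<pi>L_hat \<le> \<epsilon>L"
    and regret_F: "follower_regret G P_hat \<Pi>F \<pi>L_hat \<pi>F_hat \<le> \<epsilon>F"
    using assms(16) by (auto simp: approx_stackelberg_point_def)
  have attained: "maxima_attained G P_hat \<Pi>L \<Pi>F"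
    using assms(9) by simp
  \<comment> \<open>The supremum is taken in the complete lattice \<open>ereal\<close>, so
    \<open>SUP_le_iff\<close> yields the pointwise bounds with no boundedness side
    condition.\<close>
  have close_L: "\<bar>leader_value G P \<Pi>F \<pi>L - leader_value G P_hat \<Pi>F \<pi>L\<bar> \<le> \<delta>L"
    if "\<pi>L \<in> \<Pi>L" for \<pi>L
    using assms(15) that by (auto simp: SUP_le_iff)
  have close_F: "\<bar>policy_value Follower G P \<pi>L_hat \<pi>F - policy_value Follower G P_hat \<pi>L_hat \<pi>F\<bar> \<le> \<delta>F"
    if "\<pi>F \<in> \<Pi>F" for \<pi>F
    using assms(14) hat(1) that by (auto simp: SUP_le_iff)
  have bdd_L: "bdd_above (leader_value G P_hat \<Pi>F ` \<Pi>L)"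
    using attained by (auto simp: maxima_attained_def intro: is_arg_max_bdd_above)
  \<comment> \<open>Any element of the nonempty best-response set to \<open>\<pi>L_hat\<close>
    attains the follower maximum, hence bounds the follower values.\<close>
  have bdd_F: "bdd_above (policy_value Follower G P_hat \<pi>L_hat ` \<Pi>F)"
    using attained hat(1)
    by (fastforce simp: maxima_attained_def best_responses_def intro: is_arg_max_bdd_above)
  show "leader_regret G P \<Pi>L \<Pi>F \<pi>L_hat \<le> \<epsilon>L + 2 * \<delta>L"
    unfolding leader_regret_def
    by (rule regret_transfer[OF bdd_L close_L hat(1) regret_L[unfolded leader_regret_def]])
  show "follower_regret G P \<Pi>F \<pi>L_hat \<pi>F_hat \<le> \<epsilon>F + 2 * \<delta>F"
    unfolding follower_regret_def
    by (rule regret_transfer[OF bdd_F close_F hat(2) regret_F[unfolded follower_regret_def]])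
qed

end
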